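(* For every $\Sigma$-sentence $\phi$ of $\mathcal{L}_{BT}$: if $\mathfrak{D}\models\phi$, then $D\vdash\phi$.
   Context: Bit strings are elements of $\{\mathbf{0},\mathbf{1}\}^*$; $\varepsilon$ is the empty string. The language $\mathcal{L}_{BT}$ has constant symbols $e,0,1$, binary function symbol $\circ$ (also written as juxtaposition), and binary relation symbol $\preceq$. The structure $\mathfrak{D}$ has universe $\{\mathbf{0},\mathbf{1}\}^*$, interprets $e,0,1$ as $\varepsilon,\mathbf{0},\mathbf{1}$, $\circ$ as concatenation, and $\preceq$ as the prefix relation ($\alpha\preceq\beta$ iff $\alpha\gamma=\beta$ for some $\gamma$). $(\exists x\preceq t)\phi$ abbreviates $\exists x[x\preceq t\wedge\phi]$, $(\forall x\preceq t)\phi$ abbreviates $\forall x[x\preceq t\to\phi]$. $\Sigma$-formulas: $s\preceq t$, $\neg s\preceq t$, $s=t$, $\neg s=t$ (terms $s,t$) are $\Sigma$-formulas; they are closed under $\wedge,\vee$, and under $(\exists x\preceq t)$, $(\forall x\preceq t)$ and $\exists x$ where $x$ does not occur in $t$. The theory $D$ has the axioms: (1) $\forall x[x=ex\wedge x=xe]$; (2) $\forall xyz[(xy)z=x(yz)]$; (3) $\forall xy[x\neq y\to(x0\neq y0\wedge x1\neq y1)]$; (4) $\forall xy[x0\neq y1]$; (5) $\forall x[x\preceq e\leftrightarrow x=e]$; (6) $\forall xy[x\preceq y0\leftrightarrow(x=y0\vee x\preceq y)]$; (7) $\forall xy[x\preceq y1\leftrightarrow(x=y1\vee x\preceq y)]$.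 *)

theory Defs
  imports Main "HOL-Library.Sublist"
begin

datatype tm =
    Var nat
  | Emp (\<open>\<^bold>e\<close>)
  | Zero (\<open>\<^bold>0\<close>)
  | One (\<open>\<^bold>1\<close>)
  | Conc tm tm (infixl \<open>\<^bold>\<circ>\<close> 75)

datatype fm =
    Equ tm tm (infix \<open>\<^bold>=\<close> 60)
  | Pre tm tm (infix \<open>\<^bold>\<preceq>\<close> 60)
  | Neg fm (\<open>\<^bold>\<not> _\<close> [58] 58)
  | Conj fm fm (infixr \<open>\<^bold>\<and>\<close> 55)
  | Disj fm fm (infixr \<open>\<^bold>\<or>\<close> 50)
  | Impl fm fm (infixr \<open>\<^bold>\<longrightarrow>\<close> 45)
  | Forall nat fm
  | Exists nat fm

abbreviation Iff :: "fm \<Rightarrow> fm \<Rightarrow> fm" (infix \<open>\<^bold>\<longleftrightarrow>\<close> 44) where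
  "\<phi> \<^bold>\<longleftrightarrow> \<psi> \<equiv> (\<phi> \<^bold>\<longrightarrow> \<psi>) \<^bold>\<and> (\<psi> \<^bold>\<longrightarrow> \<phi>)"

abbreviation BExists :: "nat \<Rightarrow> tm \<Rightarrow> fm \<Rightarrow> fm" where
  "BExists x t \<phi> \<equiv> Exists x (Var x \<^bold>\<preceq> t \<^bold>\<and> \<phi>)"

abbreviation BForall :: "nat \<Rightarrow> tm \<Rightarrow> fm \<Rightarrow> fm" where
  "BForall x t \<phi> \<equiv> Forall x (Var x \<^bold>\<preceq> t \<^bold>\<longrightarrow> \<phi>)"

primrec tvars :: "tm \<Rightarrow> nat set" where
  "tvars (Var x) = {x}"
| "tvars \<^bold>e = {}"
| "tvars \<^bold>0 = {}"
| "tvars \<^bold>1 = {}"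
| "tvars (s \<^bold>\<circ> t) = tvars s \<union> tvars t"

primrec fv :: "fm \<Rightarrow> nat set" where
  "fv (s \<^bold>= t) = tvars s \<union> tvars t"
| "fv (s \<^bold>\<preceq> t) = tvars s \<union> tvars t"
| "fv (\<^bold>\<not> \<phi>) = fv \<phi>"
| "fv (\<phi> \<^bold>\<and> \<psi>) = fv \<phi> \<union> fv \<psi>"
| "fv (\<phi> \<^bold>\<or> \<psi>) = fv \<phi> \<union> fv \<psi>"
| "fv (\<phi> \<^bold>\<longrightarrow> \<psi>) = fv \<phi> \<union> fv \<psi>"
| "fv (Forall x \<phi>) = fv \<phi> - {x}"
| "fv (Exists x \<phi>) = fv \<phi> - {x}"

definition sentence :: "fm \<Rightarrow> bool" where
  "sentence \<phi> \<longleftrightarrow> fv \<phi> = {}"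

inductive Sigma_fm :: "fm \<Rightarrow> bool" where
  "Sigma_fm (s \<^bold>\<preceq> t)"
| "Sigma_fm (\<^bold>\<not> s \<^bold>\<preceq> t)"
| "Sigma_fm (s \<^bold>= t)"
| "Sigma_fm (\<^bold>\<not> s \<^bold>= t)"
| "Sigma_fm \<phi> \<Longrightarrow> Sigma_fm \<psi> \<Longrightarrow> Sigma_fm (\<phi> \<^bold>\<and> \<psi>)"
| "Sigma_fm \<phi> \<Longrightarrow> Sigma_fm \<psi> \<Longrightarrow> Sigma_fm (\<phi> \<^bold>\<or> \<psi>)"
| "Sigma_fm \<phi> \<Longrightarrow> x \<notin> tvars t \<Longrightarrow> Sigma_fm (BExists x t \<phi>)"
| "Sigma_fm \<phi> \<Longrightarrow> x \<notin> tvars t \<Longrightarrow> Sigma_fm (BForall x t \<phi>)"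
| "Sigma_fm \<phi> \<Longrightarrow> Sigma_fm (Exists x \<phi>)"

text \<open>The universe of a structure is the whole type \<open>'a\<close>.\<close>

record 'a bt_struct =
  emp_of :: 'a
  zero_of :: 'a
  one_of :: 'a
  conc_of :: "'a \<Rightarrow> 'a \<Rightarrow> 'a"
  pre_of :: "'a \<Rightarrow> 'a \<Rightarrow> bool"

primrec tval :: "'a bt_struct \<Rightarrow> (nat \<Rightarrow> 'a) \<Rightarrow> tm \<Rightarrow> 'a" where
  "tval M v (Var x) = v x"
| "tval M v \<^bold>e = emp_of M"
| "tval M v \<^bold>0 = zero_of M"
| "tval M v \<^bold>1 = one_of M"
| "tval M v (s \<^bold>\<circ> t) = conc_of M (tval M v s) (tval M v t)"

primrec sat :: "'a bt_struct \<Rightarrow> (nat \<Rightarrow> 'a) \<Rightarrow> fm \<Rightarrow> bool" where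
  "sat M v (s \<^bold>= t) \<longleftrightarrow> tval M v s = tval M v t"
| "sat M v (s \<^bold>\<preceq> t) \<longleftrightarrow> pre_of M (tval M v s) (tval M v t)"
| "sat M v (\<^bold>\<not> \<phi>) \<longleftrightarrow> \<not> sat M v \<phi>"
| "sat M v (\<phi> \<^bold>\<and> \<psi>) \<longleftrightarrow> sat M v \<phi> \<and> sat M v \<psi>"
| "sat M v (\<phi> \<^bold>\<or> \<psi>) \<longleftrightarrow> sat M v \<phi> \<or> sat M v \<psi>"
| "sat M v (\<phi> \<^bold>\<longrightarrow> \<psi>) \<longleftrightarrow> (sat M v \<phi> \<longrightarrow> sat M v \<psi>)"
| "sat M v (Forall x \<phi>) \<longleftrightarrow> (\<forall>a. sat M (v(x := a)) \<phi>)"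
| "sat M v (Exists x \<phi>) \<longleftrightarrow> (\<exists>a. sat M (v(x := a)) \<phi>)"

definition models :: "'a bt_struct \<Rightarrow> fm \<Rightarrow> bool" (infix \<open>\<Turnstile>\<close> 40) where
  "M \<Turnstile> \<phi> \<longleftrightarrow> (\<forall>v. sat M v \<phi>)"

text \<open>Bit strings are Boolean lists, with \<^const>\<open>False\<close> for the bit 0 and \<^const>\<open>True\<close> for the
  bit 1.\<close>

definition \<DD> :: "bool list bt_struct" where
  "\<DD> = \<lparr>emp_of = [], zero_of = [False], one_of = [True], conc_of = (@), pre_of = prefix\<rparr>"

primrec tsubst :: "nat \<Rightarrow> tm \<Rightarrow> tm \<Rightarrow> tm" where
  "tsubst x t (Var y) = (if y = x then t else Var y)"
| "tsubst x t \<^bold>e = \<^bold>e"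
| "tsubst x t \<^bold>0 = \<^bold>0"
| "tsubst x t \<^bold>1 = \<^bold>1"
| "tsubst x t (r \<^bold>\<circ> s) = tsubst x t r \<^bold>\<circ> tsubst x t s"

text \<open>Substitution for the free occurrences of a variable does not rename bound variables; it is
  meaningful only under the side condition \<open>free_for\<close> below.\<close>

primrec fsubst :: "nat \<Rightarrow> tm \<Rightarrow> fm \<Rightarrow> fm" where
  "fsubst x t (r \<^bold>= s) = (tsubst x t r \<^bold>= tsubst x t s)"
| "fsubst x t (r \<^bold>\<preceq> s) = (tsubst x t r \<^bold>\<preceq> tsubst x t s)"
| "fsubst x t (\<^bold>\<not> \<phi>) = (\<^bold>\<not> fsubst x t \<phi>)"
| "fsubst x t (\<phi> \<^bold>\<and> \<psi>) = (fsubst x t \<phi> \<^bold>\<and> fsubst x t \<psi>)"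
| "fsubst x t (\<phi> \<^bold>\<or> \<psi>) = (fsubst x t \<phi> \<^bold>\<or> fsubst x t \<psi>)"
| "fsubst x t (\<phi> \<^bold>\<longrightarrow> \<psi>) = (fsubst x t \<phi> \<^bold>\<longrightarrow> fsubst x t \<psi>)"
| "fsubst x t (Forall y \<phi>) = Forall y (if y = x then \<phi> else fsubst x t \<phi>)"
| "fsubst x t (Exists y \<phi>) = Exists y (if y = x then \<phi> else fsubst x t \<phi>)"

primrec free_for :: "tm \<Rightarrow> nat \<Rightarrow> fm \<Rightarrow> bool" where
  "free_for t x (r \<^bold>= s) \<longleftrightarrow> True"
| "free_for t x (r \<^bold>\<preceq> s) \<longleftrightarrow> True"
| "free_for t x (\<^bold>\<not> \<phi>) \<longleftrightarrow> free_for t x \<phi>"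
| "free_for t x (\<phi> \<^bold>\<and> \<psi>) \<longleftrightarrow> free_for t x \<phi> \<and> free_for t x \<psi>"
| "free_for t x (\<phi> \<^bold>\<or> \<psi>) \<longleftrightarrow> free_for t x \<phi> \<and> free_for t x \<psi>"
| "free_for t x (\<phi> \<^bold>\<longrightarrow> \<psi>) \<longleftrightarrow> free_for t x \<phi> \<and> free_for t x \<psi>"
| "free_for t x (Forall y \<phi>) \<longleftrightarrow> x \<notin> fv (Forall y \<phi>) \<or> (y \<notin> tvars t \<and> free_for t x \<phi>)"
| "free_for t x (Exists y \<phi>) \<longleftrightarrow> x \<notin> fv (Exists y \<phi>) \<or> (y \<notin> tvars t \<and> free_for t x \<phi>)"

text \<open>Natural deduction for classical first-order logic with equality. Since the eigenvariables of
  \<open>ForallI\<close> and \<open>ExistsE\<close> are the bound variables themselves, weakening is included as a rule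
  instead of being left to a renaming argument.\<close>

inductive derivable :: "fm set \<Rightarrow> fm \<Rightarrow> bool" (infix \<open>\<turnstile>\<close> 40) where
  Assm: "\<phi> \<in> \<Gamma> \<Longrightarrow> \<Gamma> \<turnstile> \<phi>"
| Weaken: "\<Gamma> \<turnstile> \<phi> \<Longrightarrow> \<Gamma> \<subseteq> \<Delta> \<Longrightarrow> \<Delta> \<turnstile> \<phi>"
| NegI: "insert \<phi> \<Gamma> \<turnstile> \<psi> \<Longrightarrow> insert \<phi> \<Gamma> \<turnstile> \<^bold>\<not> \<psi> \<Longrightarrow> \<Gamma> \<turnstile> \<^bold>\<not> \<phi>"
| NegE: "\<Gamma> \<turnstile> \<phi> \<Longrightarrow> \<Gamma> \<turnstile> \<^bold>\<not> \<phi> \<Longrightarrow> \<Gamma> \<turnstile> \<psi>"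
| NegNegE: "\<Gamma> \<turnstile> \<^bold>\<not> \<^bold>\<not> \<phi> \<Longrightarrow> \<Gamma> \<turnstile> \<phi>"
| ConjI: "\<Gamma> \<turnstile> \<phi> \<Longrightarrow> \<Gamma> \<turnstile> \<psi> \<Longrightarrow> \<Gamma> \<turnstile> \<phi> \<^bold>\<and> \<psi>"
| ConjE1: "\<Gamma> \<turnstile> \<phi> \<^bold>\<and> \<psi> \<Longrightarrow> \<Gamma> \<turnstile> \<phi>"
| ConjE2: "\<Gamma> \<turnstile> \<phi> \<^bold>\<and> \<psi> \<Longrightarrow> \<Gamma> \<turnstile> \<psi>"
| DisjI1: "\<Gamma> \<turnstile> \<phi> \<Longrightarrow> \<Gamma> \<turnstile> \<phi> \<^bold>\<or> \<psi>"
| DisjI2: "\<Gamma> \<turnstile> \<psi> \<Longrightarrow> \<Gamma> \<turnstile> \<phi> \<^bold>\<or> \<psi>"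
| DisjE: "\<Gamma> \<turnstile> \<phi> \<^bold>\<or> \<psi> \<Longrightarrow> insert \<phi> \<Gamma> \<turnstile> \<chi> \<Longrightarrow> insert \<psi> \<Gamma> \<turnstile> \<chi> \<Longrightarrow> \<Gamma> \<turnstile> \<chi>"
| ImplI: "insert \<phi> \<Gamma> \<turnstile> \<psi> \<Longrightarrow> \<Gamma> \<turnstile> \<phi> \<^bold>\<longrightarrow> \<psi>"
| ImplE: "\<Gamma> \<turnstile> \<phi> \<^bold>\<longrightarrow> \<psi> \<Longrightarrow> \<Gamma> \<turnstile> \<phi> \<Longrightarrow> \<Gamma> \<turnstile> \<psi>"
| ForallI: "\<Gamma> \<turnstile> \<phi> \<Longrightarrow> \<forall>\<gamma>\<in>\<Gamma>. x \<notin> fv \<gamma> \<Longrightarrow> \<Gamma> \<turnstile> Forall x \<phi>"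
| ForallE: "\<Gamma> \<turnstile> Forall x \<phi> \<Longrightarrow> free_for t x \<phi> \<Longrightarrow> \<Gamma> \<turnstile> fsubst x t \<phi>"
| ExistsI: "\<Gamma> \<turnstile> fsubst x t \<phi> \<Longrightarrow> free_for t x \<phi> \<Longrightarrow> \<Gamma> \<turnstile> Exists x \<phi>"
| ExistsE: "\<Gamma> \<turnstile> Exists x \<phi> \<Longrightarrow> insert \<phi> \<Gamma> \<turnstile> \<psi> \<Longrightarrow> \<forall>\<gamma>\<in>\<Gamma>. x \<notin> fv \<gamma> \<Longrightarrow> x \<notin> fv \<psi> \<Longrightarrow> \<Gamma> \<turnstile> \<psi>"
| EquRefl: "\<Gamma> \<turnstile> t \<^bold>= t"
| EquSubst: "\<Gamma> \<turnstile> s \<^bold>= t \<Longrightarrow> \<Gamma> \<turnstile> fsubst x s \<phi> \<Longrightarrow> free_for s x \<phi> \<Longrightarrow> free_for t x \<phi>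
    \<Longrightarrow> \<Gamma> \<turnstile> fsubst x t \<phi>"

definition D :: "fm set" where
  "D = (let x = Var 0; y = Var 1; z = Var 2 in
   {Forall 0 (x \<^bold>= \<^bold>e \<^bold>\<circ> x \<^bold>\<and> x \<^bold>= x \<^bold>\<circ> \<^bold>e),
    Forall 0 (Forall 1 (Forall 2 ((x \<^bold>\<circ> y) \<^bold>\<circ> z \<^bold>= x \<^bold>\<circ> (y \<^bold>\<circ> z)))),
    Forall 0 (Forall 1 (\<^bold>\<not> x \<^bold>= y \<^bold>\<longrightarrow> \<^bold>\<not> x \<^bold>\<circ> \<^bold>0 \<^bold>= y \<^bold>\<circ> \<^bold>0 \<^bold>\<and> \<^bold>\<not> x \<^bold>\<circ> \<^bold>1 \<^bold>= y \<^bold>\<circ> \<^bold>1)),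
    Forall 0 (Forall 1 (\<^bold>\<not> x \<^bold>\<circ> \<^bold>0 \<^bold>= y \<^bold>\<circ> \<^bold>1)),
    Forall 0 (x \<^bold>\<preceq> \<^bold>e \<^bold>\<longleftrightarrow> x \<^bold>= \<^bold>e),
    Forall 0 (Forall 1 (x \<^bold>\<preceq> y \<^bold>\<circ> \<^bold>0 \<^bold>\<longleftrightarrow> x \<^bold>= y \<^bold>\<circ> \<^bold>0 \<^bold>\<or> x \<^bold>\<preceq> y)),
    Forall 0 (Forall 1 (x \<^bold>\<preceq> y \<^bold>\<circ> \<^bold>1 \<^bold>\<longleftrightarrow> x \<^bold>= y \<^bold>\<circ> \<^bold>1 \<^bold>\<or> x \<^bold>\<preceq> y))})"

end

theory Submission
  imports Defs
begin

text \<open>Every closed term is provably equal to the canonical numeral of its value, and \<open>D\<close> decides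
  atomic formulas between numerals by recursion on the last letter. Truth of a \<open>\<Sigma>\<close>-sentence is then
  turned into provability by induction on its size: existential quantifiers are witnessed by
  numerals, and \<open>D\<close> proves that the prefixes of a numeral are exactly the finitely many numerals of
  its prefixes, which reduces a bounded universal quantifier to finitely many instances.\<close>

section \<open>Substitution\<close>

lemma finite_tvars: "finite (tvars t)"
  by (induction t) auto

lemma tsubst_fresh: "x \<notin> tvars s \<Longrightarrow> tsubst x t s = s"
  by (induction s) auto

lemma tsubst_same: "tsubst x (Var x) s = s"
  by (induction s) auto

lemma fsubst_same: "fsubst x (Var x) \<phi> = \<phi>"
  by (induction \<phi>) (auto simp: tsubst_same)

lemma free_for_same: "free_for (Var x) x \<phi>"
  by (induction \<phi>) auto

lemma free_for_closed: "tvars t = {} \<Longrightarrow> free_for t x \<phi>"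
  by (induction \<phi>) auto

lemma tvars_tsubst_closed: "tvars t = {} \<Longrightarrow> tvars (tsubst x t s) = tvars s - {x}"
  by (induction s) auto

lemma fv_fsubst_closed: "tvars t = {} \<Longrightarrow> fv (fsubst x t \<phi>) = fv \<phi> - {x}"
  by (induction \<phi>) (auto simp: tvars_tsubst_closed)

text \<open>The \<open>size\<close> of a formula ignores the terms in it. This lets an instance of a
  proper subformula count as smaller in the final induction.\<close>

lemma size_fsubst: "size (fsubst x t \<phi>) = size \<phi>"
  by (induction \<phi>) auto

lemma tval_cong: "(\<And>x. x \<in> tvars t \<Longrightarrow> v x = w x) \<Longrightarrow> tval M v t = tval M w t"
  by (induction t) auto

lemma tval_fresh: "x \<notin> tvars t \<Longrightarrow> tval M (v(x := a)) t = tval M v t"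
  by (rule tval_cong) auto

lemma tval_tsubst: "tval M v (tsubst x t s) = tval M (v(x := tval M v t)) s"
  by (induction s) auto

text \<open>The value of a closed \<open>t\<close> is immune to the updates made by quantifiers, so
  these commute with the update at \<open>x\<close>, and no variable is captured.\<close>

lemma sat_fsubst_closed:
  assumes "tvars t = {}"
  shows "sat M v (fsubst x t \<phi>) \<longleftrightarrow> sat M (v(x := tval M v t)) \<phi>"
  using assms
  by (induction \<phi> arbitrary: v) (auto simp: tval_tsubst tval_fresh fun_upd_twist)

text \<open>The side condition on bounded quantifiers survives because a closed \<open>t\<close>
  brings no variable into the bounding terms.\<close>

lemma Sigma_fm_fsubst_closed:
  assumes "Sigma_fm \<phi>" and "tvars t = {}"
  shows "Sigma_fm (fsubst x t \<phi>)"
  using assms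
  by (induction rule: Sigma_fm.induct)
    (auto intro!: Sigma_fm.intros simp: tvars_tsubst_closed tsubst_fresh)

section \<open>Derived rules\<close>

lemma contrapos:
  assumes "\<Gamma> \<turnstile> \<phi> \<^bold>\<longrightarrow> \<psi>" and "\<Gamma> \<turnstile> \<^bold>\<not> \<psi>"
  shows "\<Gamma> \<turnstile> \<^bold>\<not> \<phi>"
proof (rule NegI)
  show "insert \<phi> \<Gamma> \<turnstile> \<psi>"
    by (rule ImplE[OF Weaken[OF assms(1)] Assm]) auto
  show "insert \<phi> \<Gamma> \<turnstile> \<^bold>\<not> \<psi>"
    by (rule Weaken[OF assms(2)]) auto
qed

lemma DisjImplI:
  assumes "\<Gamma> \<turnstile> \<phi> \<^bold>\<longrightarrow> \<chi>" and "\<Gamma> \<turnstile> \<psi> \<^bold>\<longrightarrow> \<chi>"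
  shows "\<Gamma> \<turnstile> \<phi> \<^bold>\<or> \<psi> \<^bold>\<longrightarrow> \<chi>"
proof -
  let ?\<Delta> = "insert (\<phi> \<^bold>\<or> \<psi>) \<Gamma>"
  have "insert \<phi> ?\<Delta> \<turnstile> \<chi>"
    by (rule ImplE[OF Weaken[OF assms(1)] Assm]) auto
  moreover have "insert \<psi> ?\<Delta> \<turnstile> \<chi>"
    by (rule ImplE[OF Weaken[OF assms(2)] Assm]) auto
  ultimately have "?\<Delta> \<turnstile> \<chi>"
    by (rule DisjE[OF Assm, rotated]) auto
  then show ?thesis
    by (rule ImplI)
qed

lemma ImplTrans:
  assumes "\<Gamma> \<turnstile> \<phi> \<^bold>\<longrightarrow> \<psi>" and "\<Gamma> \<turnstile> \<psi> \<^bold>\<longrightarrow> \<chi>"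
  shows "\<Gamma> \<turnstile> \<phi> \<^bold>\<longrightarrow> \<chi>"
proof (rule ImplI)
  have "insert \<phi> \<Gamma> \<turnstile> \<psi>"
    by (rule ImplE[OF Weaken[OF assms(1)] Assm]) auto
  then show "insert \<phi> \<Gamma> \<turnstile> \<chi>"
    using ImplE Weaken[OF assms(2)] by blast
qed

lemma NegDisjI:
  assumes "\<Gamma> \<turnstile> \<^bold>\<not> \<phi>" and "\<Gamma> \<turnstile> \<^bold>\<not> \<psi>"
  shows "\<Gamma> \<turnstile> \<^bold>\<not> (\<phi> \<^bold>\<or> \<psi>)"
proof (rule NegI)
  let ?\<Delta> = "insert (\<phi> \<^bold>\<or> \<psi>) \<Gamma>"
  show "?\<Delta> \<turnstile> \<psi>"
  proof (rule DisjE)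
    show "?\<Delta> \<turnstile> \<phi> \<^bold>\<or> \<psi>" "insert \<psi> ?\<Delta> \<turnstile> \<psi>"
      by (auto intro: Assm)
    show "insert \<phi> ?\<Delta> \<turnstile> \<psi>"
      by (rule NegE[OF Assm Weaken[OF assms(1)]]) auto
  qed
  show "?\<Delta> \<turnstile> \<^bold>\<not> \<psi>"
    by (rule Weaken[OF assms(2)]) auto
qed

text \<open>A fresh variable marks the one place that \<open>EquSubst\<close> is to rewrite; the
  substitution then leaves the other terms alone.\<close>

lemma fresh_var: obtains x where "x \<notin> tvars r" "x \<notin> tvars s" "x \<notin> tvars t"
  using ex_new_if_finite[of "tvars r \<union> tvars s \<union> tvars t"] finite_tvars infinite_UNIV_nat
  by auto

lemma EquSym:
  assumes "\<Gamma> \<turnstile> s \<^bold>= t"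
  shows "\<Gamma> \<turnstile> t \<^bold>= s"
proof -
  obtain x where "x \<notin> tvars s" using fresh_var .
  \<comment> \<open>The template \<open>x = s\<close> turns the reflexive \<open>s = s\<close> into
    \<open>t = s\<close>.\<close>
  then show ?thesis
    using EquSubst[OF assms, of x "Var x \<^bold>= s"] by (simp add: tsubst_fresh EquRefl)
qed

lemma EquTrans:
  assumes "\<Gamma> \<turnstile> r \<^bold>= s" and "\<Gamma> \<turnstile> s \<^bold>= t"
  shows "\<Gamma> \<turnstile> r \<^bold>= t"
proof -
  obtain x where "x \<notin> tvars r" using fresh_var .
  then show ?thesis
    using EquSubst[OF assms(2), of x "r \<^bold>= Var x"] assms(1) by (simp add: tsubst_fresh)
qed

lemma ConcCong:
  assumes "\<Gamma> \<turnstile> s \<^bold>= s'" and "\<Gamma> \<turnstile> t \<^bold>= t'"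
  shows "\<Gamma> \<turnstile> s \<^bold>\<circ> t \<^bold>= s' \<^bold>\<circ> t'"
proof -
  obtain x where "x \<notin> tvars s" "x \<notin> tvars t"
    using fresh_var .
  then have *: "\<Gamma> \<turnstile> s \<^bold>\<circ> t \<^bold>= s' \<^bold>\<circ> t"
    using EquSubst[OF assms(1), of x "s \<^bold>\<circ> t \<^bold>= Var x \<^bold>\<circ> t"] by (simp add: tsubst_fresh EquRefl)
  obtain y where "y \<notin> tvars s'" "y \<notin> tvars t"
    using fresh_var .
  then have "\<Gamma> \<turnstile> s' \<^bold>\<circ> t \<^bold>= s' \<^bold>\<circ> t'"
    using EquSubst[OF assms(2), of y "s' \<^bold>\<circ> t \<^bold>= s' \<^bold>\<circ> Var y"] by (simp add: tsubst_fresh EquRefl)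
  with * show ?thesis
    by (rule EquTrans)
qed

lemma PreCong:
  assumes "\<Gamma> \<turnstile> s \<^bold>= s'" and "\<Gamma> \<turnstile> t \<^bold>= t'" and "\<Gamma> \<turnstile> s \<^bold>\<preceq> t"
  shows "\<Gamma> \<turnstile> s' \<^bold>\<preceq> t'"
proof -
  obtain x where "x \<notin> tvars t"
    using fresh_var .
  then have *: "\<Gamma> \<turnstile> s' \<^bold>\<preceq> t"
    using EquSubst[OF assms(1), of x "Var x \<^bold>\<preceq> t"] assms(3) by (simp add: tsubst_fresh)
  obtain y where "y \<notin> tvars s'"
    using fresh_var .
  then show ?thesis
    using EquSubst[OF assms(2), of y "s' \<^bold>\<preceq> Var y"] * by (simp add: tsubst_fresh)
qed

section \<open>Numerals\<close>

definition bit :: "bool \<Rightarrow> tm" where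
  "bit b = (if b then \<^bold>1 else \<^bold>0)"

text \<open>Nested to the left from \<open>e\<close>, so that the last bit is outermost: this is the
  shape \<open>y0\<close>, \<open>y1\<close> of the axioms, and the reason why the inductions use
  \<open>rev_induct\<close>.\<close>

definition num :: "bool list \<Rightarrow> tm" where
  "num = foldl (\<lambda>t b. t \<^bold>\<circ> bit b) \<^bold>e"

lemma tvars_bit [simp]: "tvars (bit b) = {}"
  by (simp add: bit_def)

lemma num_Nil [simp]: "num [] = \<^bold>e"
  by (simp add: num_def)

lemma num_snoc [simp]: "num (a @ [b]) = num a \<^bold>\<circ> bit b"
  by (simp add: num_def)

lemma tvars_num [simp]: "tvars (num a) = {}"
  by (induction a rule: rev_induct) auto

lemma DD_simps [simp]:
  "emp_of \<DD> = []" "zero_of \<DD> = [False]" "one_of \<DD> = [True]"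
  "conc_of \<DD> = (@)" "pre_of \<DD> = prefix"
  by (simp_all add: \<DD>_def)

lemma tval_DD_num [simp]: "tval \<DD> v (num a) = a"
  by (induction a rule: rev_induct) (auto simp: bit_def)

lemma sat_DD_fsubst_num: "sat \<DD> v (fsubst x (num a) \<phi>) \<longleftrightarrow> sat \<DD> (v(x := a)) \<phi>"
  by (simp add: sat_fsubst_closed)

section \<open>Instances of the axioms\<close>

text \<open>Since the axioms are sentences, the eigenvariable conditions over \<open>D\<close> hold
  for every variable.\<close>

lemma fv_D: "\<gamma> \<in> D \<Longrightarrow> fv \<gamma> = {}"
  by (auto simp: D_def Let_def)

lemma ForallE_closed: "\<Gamma> \<turnstile> Forall x \<phi> \<Longrightarrow> tvars t = {} \<Longrightarrow> \<Gamma> \<turnstile> fsubst x t \<phi>"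
  by (rule ForallE) (auto intro: free_for_closed)

lemma D_unit:
  assumes "tvars t = {}"
  shows "D \<turnstile> t \<^bold>= \<^bold>e \<^bold>\<circ> t" and "D \<turnstile> t \<^bold>= t \<^bold>\<circ> \<^bold>e"
proof -
  have "D \<turnstile> Forall 0 (Var 0 \<^bold>= \<^bold>e \<^bold>\<circ> Var 0 \<^bold>\<and> Var 0 \<^bold>= Var 0 \<^bold>\<circ> \<^bold>e)"
    by (rule Assm) (simp add: D_def Let_def)
  from ForallE_closed[OF this assms] have "D \<turnstile> t \<^bold>= \<^bold>e \<^bold>\<circ> t \<^bold>\<and> t \<^bold>= t \<^bold>\<circ> \<^bold>e"
    by simp
  then show "D \<turnstile> t \<^bold>= \<^bold>e \<^bold>\<circ> t" and "D \<turnstile> t \<^bold>= t \<^bold>\<circ> \<^bold>e"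
    by (rule ConjE1, rule ConjE2)
qed

lemma D_assoc:
  assumes "tvars r = {}" "tvars s = {}" "tvars t = {}"
  shows "D \<turnstile> (r \<^bold>\<circ> s) \<^bold>\<circ> t \<^bold>= r \<^bold>\<circ> (s \<^bold>\<circ> t)"
proof -
  have "D \<turnstile> Forall 0 (Forall 1 (Forall 2
      ((Var 0 \<^bold>\<circ> Var 1) \<^bold>\<circ> Var 2 \<^bold>= Var 0 \<^bold>\<circ> (Var 1 \<^bold>\<circ> Var 2))))"
    by (rule Assm) (simp add: D_def Let_def)
  from ForallE_closed[OF this assms(1)]
  have "D \<turnstile> Forall 1 (Forall 2 ((r \<^bold>\<circ> Var 1) \<^bold>\<circ> Var 2 \<^bold>= r \<^bold>\<circ> (Var 1 \<^bold>\<circ> Var 2)))"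
    by simp
  from ForallE_closed[OF this assms(2)]
  have "D \<turnstile> Forall 2 ((r \<^bold>\<circ> s) \<^bold>\<circ> Var 2 \<^bold>= r \<^bold>\<circ> (s \<^bold>\<circ> Var 2))"
    using assms by (simp add: tsubst_fresh)
  from ForallE_closed[OF this assms(3)] show ?thesis
    using assms by (simp add: tsubst_fresh)
qed

lemma D_snoc_inj:
  assumes "tvars s = {}" "tvars t = {}"
  shows "D \<turnstile> \<^bold>\<not> s \<^bold>= t \<^bold>\<longrightarrow> \<^bold>\<not> s \<^bold>\<circ> bit b \<^bold>= t \<^bold>\<circ> bit b"
proof -
  have "D \<turnstile> Forall 0 (Forall 1 (\<^bold>\<not> Var 0 \<^bold>= Var 1 \<^bold>\<longrightarrow>
      \<^bold>\<not> Var 0 \<^bold>\<circ> \<^bold>0 \<^bold>= Var 1 \<^bold>\<circ> \<^bold>0 \<^bold>\<and> \<^bold>\<not> Var 0 \<^bold>\<circ> \<^bold>1 \<^bold>= Var 1 \<^bold>\<circ> \<^bold>1))"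
    by (rule Assm) (simp add: D_def Let_def)
  from ForallE_closed[OF this assms(1)]
  have "D \<turnstile> Forall 1 (\<^bold>\<not> s \<^bold>= Var 1 \<^bold>\<longrightarrow>
      \<^bold>\<not> s \<^bold>\<circ> \<^bold>0 \<^bold>= Var 1 \<^bold>\<circ> \<^bold>0 \<^bold>\<and> \<^bold>\<not> s \<^bold>\<circ> \<^bold>1 \<^bold>= Var 1 \<^bold>\<circ> \<^bold>1)"
    by simp
  from ForallE_closed[OF this assms(2)]
  have *: "D \<turnstile> \<^bold>\<not> s \<^bold>= t \<^bold>\<longrightarrow> \<^bold>\<not> s \<^bold>\<circ> \<^bold>0 \<^bold>= t \<^bold>\<circ> \<^bold>0 \<^bold>\<and> \<^bold>\<not> s \<^bold>\<circ> \<^bold>1 \<^bold>= t \<^bold>\<circ> \<^bold>1"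
    using assms by (simp add: tsubst_fresh)
  have "insert (\<^bold>\<not> s \<^bold>= t) D \<turnstile> \<^bold>\<not> s \<^bold>\<circ> \<^bold>0 \<^bold>= t \<^bold>\<circ> \<^bold>0 \<^bold>\<and> \<^bold>\<not> s \<^bold>\<circ> \<^bold>1 \<^bold>= t \<^bold>\<circ> \<^bold>1"
    by (rule ImplE[OF Weaken[OF *] Assm]) auto
  then have "insert (\<^bold>\<not> s \<^bold>= t) D \<turnstile> \<^bold>\<not> s \<^bold>\<circ> bit b \<^bold>= t \<^bold>\<circ> bit b"
    by (auto simp: bit_def intro: ConjE1 ConjE2)
  then show ?thesis
    by (rule ImplI)
qed

lemma D_snoc_neq:
  assumes "tvars s = {}" "tvars t = {}" and "b \<noteq> c"
  shows "D \<turnstile> \<^bold>\<not> s \<^bold>\<circ> bit b \<^bold>= t \<^bold>\<circ> bit c"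
proof -
  have *: "D \<turnstile> \<^bold>\<not> s \<^bold>\<circ> \<^bold>0 \<^bold>= t \<^bold>\<circ> \<^bold>1" if "tvars s = {}" "tvars t = {}" for s t
  proof -
    have "D \<turnstile> Forall 0 (Forall 1 (\<^bold>\<not> Var 0 \<^bold>\<circ> \<^bold>0 \<^bold>= Var 1 \<^bold>\<circ> \<^bold>1))"
      by (rule Assm) (simp add: D_def Let_def)
    from ForallE_closed[OF this that(1)] have "D \<turnstile> Forall 1 (\<^bold>\<not> s \<^bold>\<circ> \<^bold>0 \<^bold>= Var 1 \<^bold>\<circ> \<^bold>1)"
      by simp
    from ForallE_closed[OF this that(2)] show ?thesis
      using that by (simp add: tsubst_fresh)
  qed
  show ?thesis
  proof (cases b)
    case False
    with assms *[of s t] show ?thesis by (simp add: bit_def)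
  next
    case True
    \<comment> \<open>The axiom excludes only \<open>x0 = y1\<close>; the opposite order follows by
      symmetry and contraposition.\<close>
    have "D \<turnstile> s \<^bold>\<circ> \<^bold>1 \<^bold>= t \<^bold>\<circ> \<^bold>0 \<^bold>\<longrightarrow> t \<^bold>\<circ> \<^bold>0 \<^bold>= s \<^bold>\<circ> \<^bold>1"
      by (rule ImplI, rule EquSym, rule Assm) simp
    from contrapos[OF this *] True assms show ?thesis
      by (simp add: bit_def)
  qed
qed

text \<open>The term \<open>s\<close> may be open: the matrix of the axiom is quantifier-free and
  captures nothing. Bounded universal quantifiers will use this with a variable for
  \<open>s\<close>.\<close>

lemma D_pre_Emp: "D \<turnstile> s \<^bold>\<preceq> \<^bold>e \<^bold>\<longleftrightarrow> s \<^bold>= \<^bold>e"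
proof -
  have "D \<turnstile> Forall 0 (Var 0 \<^bold>\<preceq> \<^bold>e \<^bold>\<longleftrightarrow> Var 0 \<^bold>= \<^bold>e)"
    by (rule Assm) (simp add: D_def Let_def)
  from ForallE[OF this, of s] show ?thesis
    by simp
qed

text \<open>The outer variable is instantiated last, so that \<open>s\<close> may contain the variable bound by the
  inner quantifier of the axiom.\<close>

lemma D_pre_snoc:
  assumes "tvars t = {}"
  shows "D \<turnstile> s \<^bold>\<preceq> t \<^bold>\<circ> bit b \<^bold>\<longleftrightarrow> s \<^bold>= t \<^bold>\<circ> bit b \<^bold>\<or> s \<^bold>\<preceq> t"
proof -
  let ?ax = "\<lambda>s t. s \<^bold>\<preceq> t \<^bold>\<circ> bit b \<^bold>\<longleftrightarrow> s \<^bold>= t \<^bold>\<circ> bit b \<^bold>\<or> s \<^bold>\<preceq> t"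
  have [simp]: "tsubst x r (bit b) = bit b" "tsubst x r t = t" for x r
    using assms by (simp_all add: tsubst_fresh)
  have "D \<turnstile> Forall 0 (Forall 1 (?ax (Var 0) (Var 1)))"
    by (rule Assm) (simp add: D_def Let_def bit_def)
  from ForallE[OF this free_for_same] have "D \<turnstile> Forall 1 (?ax (Var 0) (Var 1))"
    unfolding fsubst_same .
  from ForallE_closed[OF this assms] have "D \<turnstile> ?ax (Var 0) t"
    by simp
  then have "D \<turnstile> Forall 0 (?ax (Var 0) t)"
    by (rule ForallI) (simp add: fv_D)
  from ForallE[OF this, of s] show ?thesis
    by simp
qed

section \<open>Atomic formulas between closed terms\<close>

text \<open>Associativity pulls the last bit of the right factor out to the end, where
  \<open>num\<close> has it; the unit law settles the empty factor.\<close>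

lemma D_num_append: "D \<turnstile> num a \<^bold>\<circ> num b \<^bold>= num (a @ b)"
proof (induction b rule: rev_induct)
  case Nil
  show ?case by (simp add: EquSym D_unit)
next
  case (snoc c b)
  have "D \<turnstile> num a \<^bold>\<circ> (num b \<^bold>\<circ> bit c) \<^bold>= (num a \<^bold>\<circ> num b) \<^bold>\<circ> bit c"
    by (rule EquSym, rule D_assoc) auto
  moreover have "D \<turnstile> (num a \<^bold>\<circ> num b) \<^bold>\<circ> bit c \<^bold>= num (a @ b) \<^bold>\<circ> bit c"
    by (rule ConcCong[OF snoc.IH EquRefl])
  ultimately have "D \<turnstile> num a \<^bold>\<circ> (num b \<^bold>\<circ> bit c) \<^bold>= num (a @ b) \<^bold>\<circ> bit c"
    by (rule EquTrans)
  then show ?case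
    using num_snoc[of "a @ b" c] by simp
qed

text \<open>The numeral of a one-letter string is \<open>e\<close> followed by the bit, so even the
  constants \<open>0\<close> and \<open>1\<close> need the unit law.\<close>

lemma D_bit_num: "D \<turnstile> bit b \<^bold>= num [b]"
  using D_unit(1)[of "bit b"] num_snoc[of "[]" b] by simp

lemma D_closed_eq_num: "tvars t = {} \<Longrightarrow> D \<turnstile> t \<^bold>= num (tval \<DD> v t)"
proof (induction t)
  case Zero
  show ?case using D_bit_num[of False] by (simp add: bit_def)
next
  case One
  show ?case using D_bit_num[of True] by (simp add: bit_def)
next
  case (Conc s t)
  then have "D \<turnstile> s \<^bold>\<circ> t \<^bold>= num (tval \<DD> v s) \<^bold>\<circ> num (tval \<DD> v t)"
    by (intro ConcCong) auto
  from EquTrans[OF this D_num_append] show ?case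
    by simp
qed (auto intro: EquRefl)

text \<open>If \<open>e = tb\<close> and \<open>c\<close> is the other bit, then \<open>(ct)b = c(tb) = ce = ec\<close>, although the two ends have
  different last letters.\<close>

lemma D_Emp_neq_snoc:
  assumes "tvars t = {}"
  shows "D \<turnstile> \<^bold>\<not> \<^bold>e \<^bold>= t \<^bold>\<circ> bit b"
proof (rule NegI)
  let ?c = "bit (\<not> b)" and ?\<Gamma> = "insert (\<^bold>e \<^bold>= t \<^bold>\<circ> bit b) D"
  have D: "?\<Gamma> \<turnstile> \<psi>" if "D \<turnstile> \<psi>" for \<psi>
    using that by (rule Weaken) auto
  have "?\<Gamma> \<turnstile> (?c \<^bold>\<circ> t) \<^bold>\<circ> bit b \<^bold>= ?c \<^bold>\<circ> (t \<^bold>\<circ> bit b)"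
    using assms by (intro D D_assoc) auto
  moreover have "?\<Gamma> \<turnstile> ?c \<^bold>\<circ> (t \<^bold>\<circ> bit b) \<^bold>= ?c \<^bold>\<circ> \<^bold>e"
    by (rule ConcCong[OF EquRefl EquSym[OF Assm]]) auto
  moreover have "?\<Gamma> \<turnstile> ?c \<^bold>\<circ> \<^bold>e \<^bold>= ?c" "?\<Gamma> \<turnstile> ?c \<^bold>= \<^bold>e \<^bold>\<circ> ?c"
    by (auto intro!: D D_unit EquSym[OF D_unit(2)])
  ultimately show "?\<Gamma> \<turnstile> (?c \<^bold>\<circ> t) \<^bold>\<circ> bit b \<^bold>= \<^bold>e \<^bold>\<circ> ?c"
    using EquTrans by blast
  show "?\<Gamma> \<turnstile> \<^bold>\<not> (?c \<^bold>\<circ> t) \<^bold>\<circ> bit b \<^bold>= \<^bold>e \<^bold>\<circ> ?c"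
    using assms by (intro D D_snoc_neq) auto
qed

text \<open>Last letters are compared: distinct ones are separated outright, equal ones are
  cancelled and the induction hypothesis applies. If one string runs out first,
  \<open>D_Emp_neq_snoc\<close> decides.\<close>

lemma D_num_neq: "a \<noteq> b \<Longrightarrow> D \<turnstile> \<^bold>\<not> num a \<^bold>= num b"
proof (induction a arbitrary: b rule: rev_induct)
  case Nil
  then show ?case
    by (cases b rule: rev_cases) (auto intro: D_Emp_neq_snoc)
next
  case (snoc x a)
  show ?case
  proof (cases b rule: rev_cases)
    case Nil
    have "D \<turnstile> num a \<^bold>\<circ> bit x \<^bold>= \<^bold>e \<^bold>\<longrightarrow> \<^bold>e \<^bold>= num a \<^bold>\<circ> bit x"
      by (rule ImplI, rule EquSym, rule Assm) simp
    from contrapos[OF this D_Emp_neq_snoc] Nil show ?thesis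
      by simp
  next
    case b: (snoc b' y)
    show ?thesis
    proof (cases "x = y")
      case True
      with snoc b have "D \<turnstile> \<^bold>\<not> num a \<^bold>= num b'"
        by auto
      with True b show ?thesis
        using ImplE[OF D_snoc_inj] by simp
    next
      case False
      with b show ?thesis
        by (simp add: D_snoc_neq)
    qed
  qed
qed

text \<open>The axioms unfold \<open>\<preceq>\<close> along the last letter exactly as
  \<open>prefix_snoc\<close> unfolds \<open>prefix\<close>, so truth and provability recurse in
  step.\<close>

lemma D_num_pre: "prefix a b \<Longrightarrow> D \<turnstile> num a \<^bold>\<preceq> num b"
proof (induction b rule: rev_induct)
  case Nil
  then show ?case
    using ImplE[OF ConjE2[OF D_pre_Emp] EquRefl] by simp
next
  case (snoc x b)
  then have "D \<turnstile> num a \<^bold>= num b \<^bold>\<circ> bit x \<^bold>\<or> num a \<^bold>\<preceq> num b"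
    by (auto simp: prefix_snoc intro: DisjI1[OF EquRefl] DisjI2)
  from ImplE[OF ConjE2[OF D_pre_snoc] this] show ?case
    by simp
qed

text \<open>The same recursion, with both disjuncts refuted: the equation by
  \<open>D_num_neq\<close>, the shorter prefix statement by the induction hypothesis.\<close>

lemma D_num_not_pre: "\<not> prefix a b \<Longrightarrow> D \<turnstile> \<^bold>\<not> num a \<^bold>\<preceq> num b"
proof (induction b rule: rev_induct)
  case Nil
  then have "D \<turnstile> \<^bold>\<not> num a \<^bold>= \<^bold>e"
    using D_num_neq[of a "[]"] by auto
  from contrapos[OF ConjE1[OF D_pre_Emp] this] show ?case
    by simp
next
  case (snoc x b)
  then have "D \<turnstile> \<^bold>\<not> (num a \<^bold>= num b \<^bold>\<circ> bit x \<^bold>\<or> num a \<^bold>\<preceq> num b)"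
    using D_num_neq[of a "b @ [x]"] by (auto simp: prefix_snoc intro: NegDisjI)
  from contrapos[OF ConjE1[OF D_pre_snoc] this] show ?case
    by simp
qed

text \<open>The finite case distinction below a numeral. The arbitrary conclusion
  \<open>\<chi>\<close> avoids forming a disjunction over all prefixes; each letter removed from
  \<open>b\<close> contributes one equation.\<close>

lemma D_pre_num_cases:
  assumes "\<And>a. prefix a b \<Longrightarrow> D \<turnstile> s \<^bold>= num a \<^bold>\<longrightarrow> \<chi>"
  shows "D \<turnstile> s \<^bold>\<preceq> num b \<^bold>\<longrightarrow> \<chi>"
  using assms
proof (induction b rule: rev_induct)
  case Nil
  then show ?case
    using ImplTrans[OF ConjE1[OF D_pre_Emp]] by force
next
  case (snoc x b)
  have "D \<turnstile> s \<^bold>= num b \<^bold>\<circ> bit x \<^bold>\<or> s \<^bold>\<preceq> num b \<^bold>\<longrightarrow> \<chi>"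
    using snoc.prems[of "b @ [x]"] by (intro DisjImplI snoc.IH snoc.prems) (auto simp: prefix_snoc)
  from ImplTrans[OF ConjE1[OF D_pre_snoc] this] show ?case
    by simp
qed

text \<open>Both terms are traded for the numerals of their values. Equal values give one and the
  same numeral; for distinct values, \<open>s = t\<close> would equate numerals that
  \<open>D_num_neq\<close> separates.\<close>

lemma D_decides_Equ:
  assumes "tvars s = {}" "tvars t = {}"
  shows "tval \<DD> v s = tval \<DD> v t \<Longrightarrow> D \<turnstile> s \<^bold>= t"
    and "tval \<DD> v s \<noteq> tval \<DD> v t \<Longrightarrow> D \<turnstile> \<^bold>\<not> s \<^bold>= t"
proof -
  note s = D_closed_eq_num[OF assms(1), of v] and t = D_closed_eq_num[OF assms(2), of v]
  show "D \<turnstile> s \<^bold>= t" if "tval \<DD> v s = tval \<DD> v t"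
    using EquTrans[OF s] EquSym[OF t] that by simp
  show "D \<turnstile> \<^bold>\<not> s \<^bold>= t" if "tval \<DD> v s \<noteq> tval \<DD> v t"
  proof (rule contrapos[OF ImplI D_num_neq[OF that]])
    let ?\<Gamma> = "insert (s \<^bold>= t) D"
    have "?\<Gamma> \<turnstile> num (tval \<DD> v s) \<^bold>= s" "?\<Gamma> \<turnstile> s \<^bold>= t" "?\<Gamma> \<turnstile> t \<^bold>= num (tval \<DD> v t)"
      by (auto intro: Assm Weaken[OF EquSym[OF s]] Weaken[OF t])
    then show "?\<Gamma> \<turnstile> num (tval \<DD> v s) \<^bold>= num (tval \<DD> v t)"
      using EquTrans by blast
  qed
qed

lemma D_decides_Pre:
  assumes "tvars s = {}" "tvars t = {}"
  shows "prefix (tval \<DD> v s) (tval \<DD> v t) \<Longrightarrow> D \<turnstile> s \<^bold>\<preceq> t"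
    and "\<not> prefix (tval \<DD> v s) (tval \<DD> v t) \<Longrightarrow> D \<turnstile> \<^bold>\<not> s \<^bold>\<preceq> t"
proof -
  note s = D_closed_eq_num[OF assms(1), of v] and t = D_closed_eq_num[OF assms(2), of v]
  show "D \<turnstile> s \<^bold>\<preceq> t" if "prefix (tval \<DD> v s) (tval \<DD> v t)"
    by (rule PreCong[OF EquSym[OF s] EquSym[OF t] D_num_pre[OF that]])
  show "D \<turnstile> \<^bold>\<not> s \<^bold>\<preceq> t" if "\<not> prefix (tval \<DD> v s) (tval \<DD> v t)"
  proof (rule contrapos[OF ImplI D_num_not_pre[OF that]])
    show "insert (s \<^bold>\<preceq> t) D \<turnstile> num (tval \<DD> v s) \<^bold>\<preceq> num (tval \<DD> v t)"
      by (rule PreCong[OF Weaken[OF s] Weaken[OF t] Assm]) auto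
  qed
qed

section \<open>Completeness for \<open>\<Sigma>\<close>-sentences\<close>

lemma D_ExistsI_num: "D \<turnstile> fsubst x (num a) \<phi> \<Longrightarrow> D \<turnstile> Exists x \<phi>"
  by (rule ExistsI) (auto intro: free_for_closed)

text \<open>Once the bound is replaced by a numeral, only finitely many values of \<open>x\<close>
  remain, and each is settled by its instance.\<close>

lemma D_BForallI_num:
  assumes "tvars t = {}"
    and inst: "\<And>a. prefix a (tval \<DD> v t) \<Longrightarrow> D \<turnstile> fsubst x (num a) \<phi>"
  shows "D \<turnstile> BForall x t \<phi>"
proof (rule ForallI)
  have "D \<turnstile> Var x \<^bold>\<preceq> num (tval \<DD> v t) \<^bold>\<longrightarrow> \<phi>"
  proof (rule D_pre_num_cases, rule ImplI)
    fix a assume a: "prefix a (tval \<DD> v t)"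
    let ?\<Gamma> = "insert (Var x \<^bold>= num a) D"
    have "?\<Gamma> \<turnstile> num a \<^bold>= Var x"
      by (rule EquSym, rule Assm) simp
    moreover have "?\<Gamma> \<turnstile> fsubst x (num a) \<phi>"
      by (rule Weaken[OF inst[OF a]]) auto
    \<comment> \<open>Equality is used backwards, from the numeral to the variable: substituting
      \<open>x\<close> for itself recovers the open formula \<open>\<phi>\<close>.\<close>
    ultimately have "?\<Gamma> \<turnstile> fsubst x (Var x) \<phi>"
      by (rule EquSubst) (auto intro: free_for_closed free_for_same)
    then show "?\<Gamma> \<turnstile> \<phi>"
      by (simp add: fsubst_same)
  qed
  moreover have "D \<turnstile> Var x \<^bold>\<preceq> t \<^bold>\<longrightarrow> Var x \<^bold>\<preceq> num (tval \<DD> v t)"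
    by (rule ImplI, rule PreCong[OF EquRefl Weaken[OF D_closed_eq_num] Assm])
      (use assms in auto)
  ultimately show "D \<turnstile> Var x \<^bold>\<preceq> t \<^bold>\<longrightarrow> \<phi>"
    using ImplTrans by blast
qed (simp add: fv_D)

text \<open>Induction on \<open>size\<close> rather than on \<open>Sigma_fm\<close>, because the
  quantifier cases need instances \<open>fsubst x (num a) \<psi>\<close>, which are not subformulas.
  Negation occurs only at atoms, which \<open>D\<close> decides, so it is enough to follow true
  formulas.\<close>

lemma Sigma_complete:
  "Sigma_fm \<phi> \<Longrightarrow> fv \<phi> = {} \<Longrightarrow> sat \<DD> v \<phi> \<Longrightarrow> D \<turnstile> \<phi>"
proof (induction "size \<phi>" arbitrary: \<phi> rule: less_induct)
  case less
  \<comment> \<open>Naming \<open>a\<close> by its numeral moves it from the valuation into the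
    formula. The instance is again a true \<open>\<Sigma>\<close>-sentence under the same
    \<open>v\<close>, so the induction hypothesis applies.\<close>
  have inst: "D \<turnstile> fsubst x (num a) \<psi>"
    if "size \<psi> < size \<phi>" "Sigma_fm \<psi>" "fv \<psi> \<subseteq> {x}" "sat \<DD> (v(x := a)) \<psi>" for \<psi> x a
    using that
    by (intro less.hyps) (auto simp: size_fsubst Sigma_fm_fsubst_closed fv_fsubst_closed
        sat_DD_fsubst_num)
  from less.prems(1) show ?case
  proof cases
    case (1 s t)
    with less.prems show ?thesis by (auto intro: D_decides_Pre)
  next
    case (2 s t)
    with less.prems show ?thesis by (auto intro: D_decides_Pre)
  next
    case (3 s t)
    with less.prems show ?thesis by (auto intro: D_decides_Equ)
  next
    case (4 s t)
    with less.prems show ?thesis by (auto intro: D_decides_Equ)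
  next
    case (5 \<psi> \<chi>)
    with less.prems show ?thesis by (auto intro!: ConjI less.hyps)
  next
    case (6 \<psi> \<chi>)
    with less.prems show ?thesis by (auto intro: DisjI1[OF less.hyps] DisjI2[OF less.hyps])
  next
    case (7 \<psi> x t)
    \<comment> \<open>That the formula is closed leaves only \<open>x\<close> as a possible variable
      of \<open>t\<close>, and the side condition on bounded quantifiers rules it out.\<close>
    with less.prems have t: "tvars t = {}"
      by auto
    \<comment> \<open>Truth in \<open>\<DD>\<close> supplies the witness; the update at
      \<open>x\<close> does not change the value of the bound.\<close>
    from 7 less.prems obtain a where a: "prefix a (tval \<DD> v t)" "sat \<DD> (v(x := a)) \<psi>"
      by (auto simp: tval_fresh)
    have "D \<turnstile> fsubst x (num a) \<psi>"
      using 7 less.prems a by (intro inst) auto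
    moreover have "D \<turnstile> num a \<^bold>\<preceq> t"
      using t a by (intro D_decides_Pre(1)[of _ _ v]) auto
    ultimately have "D \<turnstile> fsubst x (num a) (Var x \<^bold>\<preceq> t \<^bold>\<and> \<psi>)"
      using t by (auto simp: tsubst_fresh intro: ConjI)
    with 7 show ?thesis
      by (auto intro: D_ExistsI_num)
  next
    case (8 \<psi> x t)
    with less.prems have "tvars t = {}"
      by auto
    moreover have "D \<turnstile> fsubst x (num a) \<psi>" if "prefix a (tval \<DD> v t)" for a
      using 8 less.prems that by (intro inst) (auto simp: tval_fresh)
    ultimately show ?thesis
      unfolding 8 by (rule D_BForallI_num)
  next
    case (9 \<psi> x)
    with less.prems obtain a where "sat \<DD> (v(x := a)) \<psi>"
      by auto
    with 9 less.prems have "D \<turnstile> fsubst x (num a) \<psi>"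
      by (intro inst) auto
    with 9 show ?thesis
      by (auto intro: D_ExistsI_num)
  qed
qed

theorem theorem5:
  fixes \<phi> :: fm
  assumes "Sigma_fm \<phi>" and "sentence \<phi>" and "\<DD> \<Turnstile> \<phi>"
  shows "D \<turnstile> \<phi>"
  using assms Sigma_complete by (auto simp: sentence_def models_def)

end
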